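(* For $0\le i,j\le D$: (i) $(A-\theta_jI)\tilde V_{ij}\subseteq\tilde V_{i+1,j-1}$; (ii) $(A^*-\theta^*_iI)\tilde V_{ij}\subseteq\tilde V_{i-1,j+1}$, where $\tilde V_{rs}:=0$ unless $r,s\in\{0,1,\dots,D\}$.
   Context: Let $\Gamma=(X,R)$ be a finite connected distance-regular graph with path-length distance $\partial$ and diameter $D\ge3$, $Q$-polynomial with respect to the ordering $E_0,\dots,E_D$ of its primitive idempotents (the primitive idempotents of the Bose–Mesner algebra spanned by the distance matrices; $Q$-polynomial means the Krein parameters $q^h_{ij}$, defined by $E_i\circ E_j=|X|^{-1}\sum_hq^h_{ij}E_h$, vanish whenever one of $h,i,j$ exceeds the sum of the other two and are nonzero whenever one equals the sum of the other two). Let $A$ be the adjacency matrix and write $A=\sum_{i=0}^D\theta_iE_i$. Let $V=\mathbb C^X$ with Hermitean inner product $\langle u,v\rangle=u^t\overline v$. Fix $x\in X$; for $0\le i\le D$ let $E^*_i$ be the diagonal matrix with $(E^*_i)_{yy}=1$ if $\partial(x,y)=i$ and $0$ otherwise; let $A^*$ be the diagonal matrix with $(A^* )_{yy}=|X|(E_1)_{xy}$, and write $A^*=\sum_{i=0}^D\theta^*_iE^*_i$. For $-1\le i,j\le D$ define $V_{ij}=(E^*_0V+\cdots+E^*_iV)\cap(E_0V+\cdots+E_jV)$ (so $V_{ij}=0$ if $i=-1$ or $j=-1$). For $0\le i,j\le D$ let $\tilde V_{ij}$ be the orthogonal complement of $V_{i,j-1}+V_{i-1,j}$ in $V_{ij}$.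 *)

theory Defs
  imports Complex_Main
begin

text \<open>Vertex set X = UNIV of a finite type 'a; V = C^X is 'a => complex;
 matrices indexed by X are 'a => 'a => complex.\<close>

type_synonym 'a cvec = "'a \<Rightarrow> complex"
type_synonym 'a cmat = "'a \<Rightarrow> 'a \<Rightarrow> complex"

definition mmul :: "('a::finite) cmat \<Rightarrow> 'a cmat \<Rightarrow> 'a cmat" where
  "mmul M N = (\<lambda>y z. \<Sum>w\<in>UNIV. M y w * N w z)"

definition mapp :: "('a::finite) cmat \<Rightarrow> 'a cvec \<Rightarrow> 'a cvec" where
  "mapp M v = (\<lambda>y. \<Sum>w\<in>UNIV. M y w * v w)"

definition idm :: "'a cmat" where
  "idm = (\<lambda>y z. if y = z then 1 else 0)"

definition hadamard :: "'a cmat \<Rightarrow> 'a cmat \<Rightarrow> 'a cmat" where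
  "hadamard M N = (\<lambda>y z. M y z * N y z)"

definition cinner :: "('a::finite) cvec \<Rightarrow> 'a cvec \<Rightarrow> complex" where
  "cinner u v = (\<Sum>y\<in>UNIV. u y * cnj (v y))"

definition gdist :: "('a \<Rightarrow> 'a \<Rightarrow> bool) \<Rightarrow> 'a \<Rightarrow> 'a \<Rightarrow> nat" where
  "gdist Adj y z = (LEAST n. (Adj ^^ n) y z)"

definition diameter :: "('a::finite \<Rightarrow> 'a \<Rightarrow> bool) \<Rightarrow> nat" where
  "diameter Adj = Max {gdist Adj y z | y z. True}"

definition distance_regular :: "('a::finite \<Rightarrow> 'a \<Rightarrow> bool) \<Rightarrow> bool" where
  "distance_regular Adj \<longleftrightarrow>
     (\<forall>y z. Adj y z \<longrightarrow> Adj z y) \<and> (\<forall>y. \<not> Adj y y) \<and>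
     (\<forall>y z. \<exists>n. (Adj ^^ n) y z) \<and>
     (\<forall>h i j. \<exists>p::nat. \<forall>y z. gdist Adj y z = h \<longrightarrow>
         card {w. gdist Adj y w = i \<and> gdist Adj z w = j} = p)"

definition adjmat :: "('a \<Rightarrow> 'a \<Rightarrow> bool) \<Rightarrow> 'a cmat" where
  "adjmat Adj = (\<lambda>y z. if Adj y z then 1 else 0)"

definition distmat :: "('a \<Rightarrow> 'a \<Rightarrow> bool) \<Rightarrow> nat \<Rightarrow> 'a cmat" where
  "distmat Adj i = (\<lambda>y z. if gdist Adj y z = i then 1 else 0)"

definition bose_mesner :: "('a::finite \<Rightarrow> 'a \<Rightarrow> bool) \<Rightarrow> 'a cmat set" where
  "bose_mesner Adj = {M. \<exists>c::nat \<Rightarrow> complex.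
      M = (\<lambda>y z. \<Sum>i\<le>diameter Adj. c i * distmat Adj i y z)}"

definition primitive_idempotent :: "('a::finite \<Rightarrow> 'a \<Rightarrow> bool) \<Rightarrow> 'a cmat \<Rightarrow> bool" where
  "primitive_idempotent Adj E \<longleftrightarrow>
     E \<in> bose_mesner Adj \<and> E \<noteq> (\<lambda>_ _. 0) \<and> mmul E E = E \<and>
     (\<forall>F\<in>bose_mesner Adj. mmul F F = F \<and> mmul E F = F \<longrightarrow> F = (\<lambda>_ _. 0) \<or> F = E)"

text \<open>Q-polynomial w.r.t. the ordering E 0, ..., E D, via the Krein parameters
 q h i j defined by  E_i o E_j = |X|^-1 sum_h q^h_ij E_h.\<close>
definition Q_polynomial :: "('a::finite \<Rightarrow> 'a \<Rightarrow> bool) \<Rightarrow> (nat \<Rightarrow> 'a cmat) \<Rightarrow> bool" where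
  "Q_polynomial Adj E \<longleftrightarrow> (\<exists>q::nat \<Rightarrow> nat \<Rightarrow> nat \<Rightarrow> complex.
     (\<forall>i\<le>diameter Adj. \<forall>j\<le>diameter Adj.
        hadamard (E i) (E j) =
        (\<lambda>y z. (1 / of_nat (card (UNIV::'a set))) * (\<Sum>h\<le>diameter Adj. q h i j * E h y z))) \<and>
     (\<forall>h\<le>diameter Adj. \<forall>i\<le>diameter Adj. \<forall>j\<le>diameter Adj.
        ((h > i + j \<or> i > h + j \<or> j > h + i) \<longrightarrow> q h i j = 0) \<and>
        ((h = i + j \<or> i = h + j \<or> j = h + i) \<longrightarrow> q h i j \<noteq> 0)))"

definition dual_idem :: "('a \<Rightarrow> 'a \<Rightarrow> bool) \<Rightarrow> 'a \<Rightarrow> nat \<Rightarrow> 'a cmat" where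
  "dual_idem Adj x i = (\<lambda>y z. if y = z \<and> gdist Adj x y = i then 1 else 0)"

definition dual_adj :: "(nat \<Rightarrow> ('a::finite) cmat) \<Rightarrow> 'a \<Rightarrow> 'a cmat" where
  "dual_adj E x = (\<lambda>y z. if y = z then of_nat (card (UNIV::'a set)) * E 1 x y else 0)"

definition sum_images :: "(nat \<Rightarrow> ('a::finite) cmat) \<Rightarrow> nat \<Rightarrow> 'a cvec set" where
  "sum_images M n = {v. \<exists>w::nat \<Rightarrow> 'a cvec. v = (\<lambda>y. \<Sum>k\<le>n. mapp (M k) (w k) y)}"

definition set_plus_v :: "'a cvec set \<Rightarrow> 'a cvec set \<Rightarrow> 'a cvec set" where
  "set_plus_v S T = {(\<lambda>y. a y + b y) | a b. a \<in> S \<and> b \<in> T}"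

definition Vsp :: "('a::finite \<Rightarrow> 'a \<Rightarrow> bool) \<Rightarrow> (nat \<Rightarrow> 'a cmat) \<Rightarrow> 'a \<Rightarrow> int \<Rightarrow> int \<Rightarrow> 'a cvec set" where
  "Vsp Adj E x i j = (if i < 0 \<or> j < 0 then {\<lambda>_. 0}
      else sum_images (dual_idem Adj x) (nat i) \<inter> sum_images E (nat j))"

definition Vtil :: "('a::finite \<Rightarrow> 'a \<Rightarrow> bool) \<Rightarrow> (nat \<Rightarrow> 'a cmat) \<Rightarrow> 'a \<Rightarrow> int \<Rightarrow> int \<Rightarrow> 'a cvec set" where
  "Vtil Adj E x r s = (if 0 \<le> r \<and> r \<le> int (diameter Adj) \<and> 0 \<le> s \<and> s \<le> int (diameter Adj)
      then {v \<in> Vsp Adj E x r s. \<forall>u \<in> set_plus_v (Vsp Adj E x r (s - 1)) (Vsp Adj E x (r - 1) s).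
               cinner v u = 0}
      else {\<lambda>_. 0})"

end

theory Submission
  imports Defs "HOL-Analysis.Linear_Algebra" "HOL-Analysis.Finite_Cartesian_Product"
    "HOL-Library.Function_Algebras"
begin

text \<open>
  Let S_n be the sum of the V_kl with k + l = n. Since A - \<theta>_l maps V_kl into V_{k+1,l-1} and
  A* - \<theta>*_k maps V_kl into V_{k-1,l+1}, the space S_n is invariant under A and A*, hence under all
  E_k and E*_k, and the orthogonal projection onto S_n preserves every V_ij. Moreover the
  intersection of V_ij with S_{i+j-1} is V_{i,j-1} + V_{i-1,j}. So the complement of
  V_{i,j-1} + V_{i-1,j} in V_ij is the part of V_ij orthogonal to S_{i+j-1}. As S_{i+j-1} is
  invariant under the Hermitian matrices A and A*, both maps of the theorem preserve the
  orthogonality to S_{i+j-1}, and i + j is the same for source and target.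
\<close>

subsection \<open>Linear algebra of vectors and matrices\<close>

text \<open>The sum \<open>V_{i,j-1} + V_{i-1,j}\<close> need not be invariant by itself:
  \<open>A\<close> and \<open>A*\<close> push its pieces to neighbouring places with the same index
  sum. Closing up gives the whole antidiagonal, whose ends leak nothing, because
  \<open>A - \<theta>_0\<close> kills \<open>V_{n,0}\<close> and \<open>A* - \<theta>*_0\<close>
  kills \<open>V_{0,n}\<close>. The projection preserves \<open>V_ij\<close> because
  \<open>V_ij\<close> is the common kernel of the Hermitian operators \<open>E_k\<close> (k > j) and
  \<open>E*_k\<close> (k > i), and such an operator commutes with the projection onto a subspace
  that it maps to itself. Passing from \<open>A\<close> to \<open>E_k\<close> uses the products of
  \<open>A\<close> with distance matrices, whose top intersection number is positive; passing from
  \<open>A*\<close> to \<open>E*_k\<close> uses entrywise products with \<open>E_1\<close>, whose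
  top Krein parameter is nonzero. That \<open>A*\<close> climbs at most one step in the ordering of
  the \<open>E_k\<close> mirrors the triangle inequality and rests on \<open>q^1_{hj} = 0\<close>
  for h > j + 1. Primitivity is given only as minimality inside a complex algebra, so symmetry,
  realness, mutual orthogonality and completeness of the \<open>E_k\<close> have to be
  derived.\<close>

lemma mapp_mmul: "mapp (mmul M N) v = mapp M (mapp N v)"
  unfolding mapp_def mmul_def
  by (rule ext, simp add: sum_distrib_left sum_distrib_right mult.assoc, rule sum.swap)

lemma mmul_assoc: "mmul (mmul M N) L = mmul M (mmul N L)"
  unfolding mmul_def
  by (intro ext, simp add: sum_distrib_left sum_distrib_right mult.assoc, rule sum.swap)

lemma mapp_add: "mapp M (\<lambda>y. u y + v y) = (\<lambda>y. mapp M u y + mapp M v y)"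
  unfolding mapp_def by (simp add: algebra_simps sum.distrib)

lemma mapp_scale: "mapp M (\<lambda>y. c * v y) = (\<lambda>y. c * mapp M v y)"
  unfolding mapp_def by (simp add: sum_distrib_left mult_ac)

lemma mapp_zero: "mapp M (\<lambda>_. 0) = (\<lambda>_. 0)"
  unfolding mapp_def by simp

lemma mapp_sum: "mapp M (\<lambda>y. \<Sum>k\<in>K. f k y) = (\<lambda>y. \<Sum>k\<in>K. mapp M (f k) y)"
  unfolding mapp_def by (rule ext, simp add: sum_distrib_left, rule sum.swap)

lemma mapp_mat_sum:
  "mapp (\<lambda>y z. \<Sum>k\<in>K. c k * M k y z) v = (\<lambda>y. \<Sum>k\<in>K. c k * mapp (M k) v y)"
  unfolding mapp_def
  by (rule ext, simp add: sum_distrib_left sum_distrib_right mult.assoc, rule sum.swap)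

lemma mapp_idm: "mapp idm v = v"
  unfolding mapp_def idm_def by (simp add: if_distrib[of "\<lambda>t. t * _"] cong: if_cong)

lemma mmul_sum_right:
  "mmul N (\<lambda>y z. \<Sum>k\<in>K. c k * M k y z) = (\<lambda>y z. \<Sum>k\<in>K. c k * mmul N (M k) y z)"
  unfolding mmul_def
  by (intro ext, simp add: sum_distrib_left mult_ac, rule sum.swap)

lemma mmul_sum_left:
  "mmul (\<lambda>y z. \<Sum>k\<in>K. c k * M k y z) N = (\<lambda>y z. \<Sum>k\<in>K. c k * mmul (M k) N y z)"
  unfolding mmul_def
  by (intro ext, simp add: sum_distrib_left sum_distrib_right mult_ac, rule sum.swap)

lemma mapp_shift:
  "mapp (\<lambda>y z. M y z - c * idm y z) v = (\<lambda>y. mapp M v y + (- c) * v y)"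
proof -
  have "mapp (\<lambda>y z. M y z - c * idm y z) v = (\<lambda>y. mapp M v y - c * mapp idm v y)"
    unfolding mapp_def by (simp add: algebra_simps sum_subtractf sum_distrib_left)
  then show ?thesis by (simp add: mapp_idm)
qed

definition cvec_subspace :: "'a cvec set \<Rightarrow> bool" where
  "cvec_subspace S \<longleftrightarrow> (\<lambda>_. 0) \<in> S \<and> (\<forall>u\<in>S. \<forall>v\<in>S. (\<lambda>y. u y + v y) \<in> S) \<and>
     (\<forall>c. \<forall>v\<in>S. (\<lambda>y. c * v y) \<in> S)"

lemma cvec_subspace_zero: "cvec_subspace S \<Longrightarrow> (\<lambda>_. 0) \<in> S"
  and cvec_subspace_add: "cvec_subspace S \<Longrightarrow> u \<in> S \<Longrightarrow> v \<in> S \<Longrightarrow> (\<lambda>y. u y + v y) \<in> S"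
  and cvec_subspace_scale: "cvec_subspace S \<Longrightarrow> v \<in> S \<Longrightarrow> (\<lambda>y. c * v y) \<in> S"
  unfolding cvec_subspace_def by auto

lemma cvec_subspace_diff:
  assumes "cvec_subspace S" "u \<in> S" "v \<in> S"
  shows "(\<lambda>y. u y - v y) \<in> S"
  using cvec_subspace_add[OF assms(1,2) cvec_subspace_scale[OF assms(1,3), of "-1"]] by simp

lemma cvec_subspace_sum:
  assumes "cvec_subspace S" "finite K" "\<And>k. k \<in> K \<Longrightarrow> f k \<in> S"
  shows "(\<lambda>y. \<Sum>k\<in>K. f k y) \<in> S"
  using assms(2,3)
  by (induction K rule: finite_induct)
    (auto simp: cvec_subspace_zero[OF assms(1)] intro: cvec_subspace_add[OF assms(1)])

lemma cinner_add_left: "cinner (\<lambda>y. u y + v y) w = cinner u w + cinner v w"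
  unfolding cinner_def by (simp add: algebra_simps sum.distrib)

lemma cinner_add_right: "cinner w (\<lambda>y. u y + v y) = cinner w u + cinner w v"
  unfolding cinner_def by (simp add: algebra_simps sum.distrib)

lemma cinner_scale_left: "cinner (\<lambda>y. c * v y) w = c * cinner v w"
  unfolding cinner_def by (simp add: sum_distrib_left mult_ac)

lemma cinner_scale_right: "cinner w (\<lambda>y. c * v y) = cnj c * cinner w v"
  unfolding cinner_def by (simp add: sum_distrib_left mult_ac)

lemma cinner_self: "cinner v v = complex_of_real (\<Sum>y\<in>UNIV. (cmod (v y))\<^sup>2)"
  unfolding cinner_def by (simp only: of_real_sum complex_norm_square)

lemma cinner_self_eq_0:
  assumes "cinner v v = 0" shows "v = (\<lambda>_. 0)"
proof
  fix y
  have "(\<Sum>y\<in>UNIV. (cmod (v y))\<^sup>2) = 0" using assms by (metis cinner_self of_real_eq_0_iff)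
  then show "v y = 0" by (simp add: sum_nonneg_eq_0_iff)
qed

lemma cinner_mapp_hermitian:
  assumes "\<And>y z. cnj (M y z) = M z y"
  shows "cinner (mapp M u) v = cinner u (mapp M v)"
  unfolding cinner_def mapp_def
  by (simp add: sum_distrib_left sum_distrib_right assms mult_ac, rule sum.swap)

text \<open>A complex subspace is also a real subspace of \<open>complex ^ 'a\<close>, whose real
  inner product is the real part of \<open>cinner\<close>. Real orthogonality to both
  \<open>u\<close> and \<open>\<i> * u\<close> amounts to complex orthogonality to
  \<open>u\<close>.\<close>

lemma cvec_orthogonal_decomposition:
  fixes S :: "('a::finite) cvec set"
  assumes S: "cvec_subspace S"
  obtains p r where "p \<in> S" "\<And>u. u \<in> S \<Longrightarrow> cinner r u = 0" "v = (\<lambda>y. p y + r y)"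
proof -
  define T :: "(complex ^ 'a) set" where "T = (\<lambda>f. \<chi> y. f y) ` S"
  have T_iff: "t \<in> T \<longleftrightarrow> (\<lambda>y. t $ y) \<in> S" for t
    unfolding T_def by (force simp: vec_eq_iff image_iff intro: bexI[of _ "\<lambda>y. t $ y"])
  have "subspace T"
    unfolding subspace_def T_iff zero_index vector_add_component vector_scaleR_component
    using cvec_subspace_zero[OF S] cvec_subspace_add[OF S] cvec_subspace_scale[OF S]
    by (simp add: scaleR_conv_of_real[where 'a=complex] Ball_def T_iff)
  then have span: "span T = T" by simp
  obtain p r where pr: "p \<in> T" "\<And>w. w \<in> T \<Longrightarrow> orthogonal r w" "(\<chi> y. v y) = p + r"
    using orthogonal_subspace_decomp_exists[of T "\<chi> y. v y"] span by metis
  have Re0: "Re (cinner (\<lambda>y. r $ y) u) = 0" if "u \<in> S" for u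
  proof -
    have "(\<chi> y. u y) \<in> T" using that by (simp add: T_iff)
    then have "r \<bullet> (\<chi> y. u y) = 0" using pr(2) by (simp add: orthogonal_def)
    then show ?thesis by (simp add: inner_vec_def cinner_def inner_complex_def)
  qed
  have "cinner (\<lambda>y. r $ y) u = 0" if u: "u \<in> S" for u
  proof (rule complex_eqI)
    show "Re (cinner (\<lambda>y. r $ y) u) = Re 0" using Re0[OF u] by simp
    have "Re (cinner (\<lambda>y. r $ y) (\<lambda>y. \<i> * u y)) = 0"
      by (rule Re0, rule cvec_subspace_scale[OF S u])
    then show "Im (cinner (\<lambda>y. r $ y) u) = Im 0" by (simp add: cinner_scale_right)
  qed
  moreover have "v = (\<lambda>y. p $ y + r $ y)" using pr(3) by (auto simp: vec_eq_iff)
  moreover have "(\<lambda>y. p $ y) \<in> S" using pr(1) T_iff by simp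
  ultimately show ?thesis using that by blast
qed

text \<open>Steinitz exchange: a \<open>C i\<close> outside the span of the \<open>B k\<close> would
  give n + 2 independent vectors in a space spanned by n + 1. It serves to express the distance
  matrices through the idempotents.\<close>

lemma exchange_spanning_family:
  fixes B C :: "nat \<Rightarrow> 'b \<Rightarrow> complex"
  assumes BC: "\<And>k. k \<le> n \<Longrightarrow> B k = (\<lambda>p. \<Sum>i\<le>n. m k i * C i p)"
    and indep: "\<And>c. (\<And>p. (\<Sum>k\<le>n. c k * B k p) = 0) \<Longrightarrow> \<forall>k\<le>n. c k = (0::complex)"
    and i: "i \<le> n"
  shows "\<exists>c. C i = (\<lambda>p. \<Sum>k\<le>n. c k * B k p)"
proof -
  interpret vs: vector_space "\<lambda>(c::complex) (f::'b \<Rightarrow> complex). (\<lambda>p. c * f p)"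
    by unfold_locales (auto simp: fun_eq_iff algebra_simps)
  have sum_apply: "(\<Sum>k\<in>K. f k) p = (\<Sum>k\<in>K. f k p)"
    for f :: "'c \<Rightarrow> 'b \<Rightarrow> complex" and K p
    by (induction K rule: infinite_finite_induct) auto
  \<comment> \<open>The dimension count is about sets, so the indexed family must have no
    repetition; \<open>B a = B b\<close> would give a relation with coefficients 1 and -1.\<close>
  have inj: "inj_on B {..n}"
  proof (rule inj_onI, rule ccontr)
    fix a b assume ab: "a \<in> {..n}" "b \<in> {..n}" "B a = B b" "a \<noteq> b"
    define c :: "nat \<Rightarrow> complex" where "c = (\<lambda>k. if k = a then 1 else if k = b then -1 else 0)"
    have "(\<Sum>k\<le>n. c k * B k p) = 0" for p
    proof -
      have "(\<Sum>k\<le>n. c k * B k p) =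
          (\<Sum>k\<le>n. (if k = a then B a p else 0) - (if k = b then B b p else 0))"
        using ab(4) by (intro sum.cong) (auto simp: c_def)
      also have "\<dots> = 0" using ab by (simp add: sum_subtractf)
      finally show ?thesis .
    qed
    then have "c a = 0" using indep[of c] ab(1) by auto
    then show False by (simp add: c_def)
  qed
  let ?s = "B ` {..n}" and ?t = "C ` {..n}"
  have s_indep: "vs.independent ?s"
  proof (rule vs.independent_if_scalars_zero)
    fix f v assume sum0: "(\<Sum>v\<in>?s. (\<lambda>p. f v * v p)) = 0" and v: "v \<in> ?s"
    have "(\<Sum>k\<le>n. f (B k) * B k p) = 0" for p
      using fun_cong[OF sum0, of p] by (simp add: sum_apply sum.reindex[OF inj])
    then have "\<forall>k\<le>n. f (B k) = 0" by (rule indep)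
    then show "f v = 0" using v by auto
  qed simp
  have s_span: "?s \<subseteq> vs.span ?t"
  proof safe
    fix k assume "k \<le> n"
    then have "B k = (\<Sum>i\<le>n. (\<lambda>p. m k i * C i p))" using BC by (auto simp: sum_apply)
    also have "\<dots> \<in> vs.span ?t"
      by (intro vs.span_sum vs.span_scale vs.span_base) auto
    finally show "B k \<in> vs.span ?t" .
  qed
  have "C i \<in> vs.span ?s"
  proof (rule ccontr)
    assume C: "C i \<notin> vs.span ?s"
    then have "vs.independent (insert (C i) ?s)" using s_indep by (simp add: vs.independent_insert)
    moreover have "insert (C i) ?s \<subseteq> vs.span ?t" using s_span i by (auto intro: vs.span_base)
    ultimately have "card (insert (C i) ?s) \<le> card ?t"
      using vs.independent_span_bound by blast
    moreover have "C i \<notin> ?s" using C vs.span_base[of "C i" ?s] by argo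
    then have "card (insert (C i) ?s) = n + 2" by (simp add: card_image[OF inj])
    moreover have "card ?t \<le> n + 1" using card_image_le[of "{..n}" C] by simp
    ultimately show False by simp
  qed
  then obtain u where "C i = (\<Sum>v\<in>?s. (\<lambda>p. u v * v p))" by (auto simp: vs.span_finite)
  then have "C i = (\<lambda>p. \<Sum>k\<le>n. u (B k) * B k p)"
    by (simp add: fun_eq_iff sum_apply sum.reindex[OF inj])
  then show ?thesis by (rule exI[of _ "\<lambda>k. u (B k)"])
qed

subsection \<open>Distances and the Bose-Mesner algebra\<close>

locale q_polynomial_drg =
  fixes Adj :: "'a::finite \<Rightarrow> 'a \<Rightarrow> bool"
    and E :: "nat \<Rightarrow> 'a cmat"
    and \<theta> \<theta>s :: "nat \<Rightarrow> complex"
    and x :: 'a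
  assumes drg: "distance_regular Adj"
    and diam: "diameter Adj \<ge> 1"
    and prim: "bij_betw E {..diameter Adj} {F. primitive_idempotent Adj F}"
    and qpoly: "Q_polynomial Adj E"
    and eig: "adjmat Adj = (\<lambda>y z. \<Sum>k\<le>diameter Adj. \<theta> k * E k y z)"
    and dualeig: "dual_adj E x = (\<lambda>y z. \<Sum>k\<le>diameter Adj. \<theta>s k * dual_idem Adj x k y z)"
begin

abbreviation "d \<equiv> gdist Adj"
abbreviation "D \<equiv> diameter Adj"
abbreviation "A \<equiv> adjmat Adj"
abbreviation "Astar \<equiv> dual_adj E x"

lemma Adj_sym: "Adj y z \<Longrightarrow> Adj z y"
  and Adj_irrefl: "\<not> Adj y y"
  and connected: "\<exists>n. (Adj ^^ n) y z"
  using drg unfolding distance_regular_def by auto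

lemma dist_le_path: "(Adj ^^ n) y z \<Longrightarrow> d y z \<le> n"
  unfolding gdist_def by (rule Least_le)

lemma dist_path: "(Adj ^^ d y z) y z"
  unfolding gdist_def by (rule LeastI_ex[OF connected])

lemma path_sym: "(Adj ^^ n) y z \<Longrightarrow> (Adj ^^ n) z y"
proof (induction n arbitrary: z)
  case (Suc n)
  then obtain w where "(Adj ^^ n) y w" "Adj w z" by auto
  then show ?case using Suc.IH Adj_sym relpowp_Suc_I2 by metis
qed simp

lemma dist_sym: "d y z = d z y"
  by (meson dist_le_path dist_path path_sym order_antisym)

lemma dist_eq_0: "d y z = 0 \<longleftrightarrow> y = z"
proof
  assume "d y z = 0" then show "y = z" using dist_path[of y z] by simp
next
  assume "y = z" then show "d y z = 0" using dist_le_path[of 0 y z] by simp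
qed

lemma dist_eq_1: "d y z = 1 \<longleftrightarrow> Adj y z"
proof
  assume "d y z = 1" then show "Adj y z" using dist_path[of y z] by (auto simp: OO_def)
next
  assume a: "Adj y z"
  then have "d y z \<le> 1" using dist_le_path[of 1 y z] by (auto simp: OO_def)
  moreover have "d y z \<noteq> 0" using a Adj_irrefl dist_eq_0 by auto
  ultimately show "d y z = 1" by simp
qed

lemma dist_step: "Adj z w \<Longrightarrow> d y w \<le> Suc (d y z)"
  using dist_le_path relpowp_Suc_I[OF dist_path] by blast

lemma dist_predecessor:
  assumes "d y z = Suc n" obtains w where "d y w = n" "Adj w z"
proof -
  obtain w where w: "(Adj ^^ n) y w" "Adj w z"
    using dist_path[of y z] assms by auto
  have "d y w \<le> n" "Suc n \<le> Suc (d y w)" using dist_le_path[OF w(1)] dist_step[OF w(2)] assms by metis+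
  then show ?thesis using that[of w] w(2) by simp
qed

lemma dist_le_diameter: "d y z \<le> D"
proof -
  have "{d y z | y z. True} = (\<lambda>(y, z). d y z) ` UNIV" by auto
  then have "finite {d y z | y z. True}" by simp
  then show ?thesis unfolding diameter_def by (rule Max_ge) blast
qed

text \<open>For \<open>h\<close> that is not a distance the choice is arbitrary; such a value is
  either never evaluated or multiplied by a zero distance matrix.\<close>

definition intersection_number :: "nat \<Rightarrow> nat \<Rightarrow> nat \<Rightarrow> nat" where
  "intersection_number h i j =
     (SOME p. \<forall>y z. d y z = h \<longrightarrow> card {w. d y w = i \<and> d z w = j} = p)"

lemma card_intersection: "card {w. d y w = i \<and> d z w = j} = intersection_number (d y z) i j"
proof -
  have "\<exists>p. \<forall>y' z'. d y' z' = d y z \<longrightarrow> card {w. d y' w = i \<and> d z' w = j} = p"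
    using drg unfolding distance_regular_def by blast
  from someI_ex[OF this] show ?thesis unfolding intersection_number_def by blast
qed

lemma mmul_distmat:
  "mmul (distmat Adj i) (distmat Adj j) = (\<lambda>y z. of_nat (intersection_number (d y z) i j))"
proof (intro ext)
  fix y z
  have "mmul (distmat Adj i) (distmat Adj j) y z =
      (\<Sum>w\<in>UNIV. if w \<in> {w. d y w = i \<and> d z w = j} then 1 else 0)"
    unfolding mmul_def distmat_def by (intro sum.cong) (auto simp: dist_sym)
  also have "\<dots> = of_nat (card {w. d y w = i \<and> d z w = j})"
    by (subst sum.inter_filter[symmetric]) simp_all
  finally show "mmul (distmat Adj i) (distmat Adj j) y z = of_nat (intersection_number (d y z) i j)"
    by (simp add: card_intersection)
qed

lemma adjmat_distmat: "A = distmat Adj 1"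
  unfolding adjmat_def distmat_def by (simp add: dist_eq_1[symmetric])

lemma sum_distmat: "(\<Sum>i\<le>D. c i * distmat Adj i y z) = c (d y z)"
  unfolding distmat_def using dist_le_diameter[of y z]
  by (simp add: if_distrib[of "\<lambda>t. _ * t"] cong: if_cong)

text \<open>The distance matrices have disjoint supports covering all pairs of vertices, so their
  combinations are the functions of the distance. Symmetry and closure under conjugation can then be
  read off.\<close>

lemma bose_mesner_iff: "M \<in> bose_mesner Adj \<longleftrightarrow> (\<exists>c. M = (\<lambda>y z. c (d y z)))"
  unfolding bose_mesner_def by (simp add: sum_distmat)

lemma bose_mesner_sym: "M \<in> bose_mesner Adj \<Longrightarrow> M y z = M z y"
  unfolding bose_mesner_iff by (auto simp: dist_sym)

lemma bose_mesner_mmul: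
  assumes "M \<in> bose_mesner Adj" "N \<in> bose_mesner Adj"
  shows "mmul M N \<in> bose_mesner Adj"
proof -
  obtain c c' where M: "M = (\<lambda>y z. \<Sum>i\<le>D. c i * distmat Adj i y z)"
    and N: "N = (\<lambda>y z. \<Sum>i\<le>D. c' i * distmat Adj i y z)"
    using assms unfolding bose_mesner_def by blast
  have "mmul M N = (\<lambda>y z. \<Sum>i\<le>D. c i * (\<Sum>j\<le>D. c' j * of_nat (intersection_number (d y z) i j)))"
    unfolding M N mmul_sum_left mmul_sum_right mmul_distmat ..
  then show ?thesis unfolding bose_mesner_iff
    by (intro exI[of _ "\<lambda>h. \<Sum>i\<le>D. c i * (\<Sum>j\<le>D. c' j * of_nat (intersection_number h i j))"])
qed

text \<open>Transposition reverses a product, while both factors and the product itself are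
  symmetric.\<close>

lemma bose_mesner_commute:
  assumes "M \<in> bose_mesner Adj" "N \<in> bose_mesner Adj"
  shows "mmul M N = mmul N M"
proof (intro ext)
  fix y z
  have "mmul M N y z = mmul M N z y" by (rule bose_mesner_sym[OF bose_mesner_mmul[OF assms]])
  also have "\<dots> = mmul N M y z" unfolding mmul_def
    by (simp add: bose_mesner_sym[OF assms(1), of z] bose_mesner_sym[OF assms(2), of _ y] mult.commute)
  finally show "mmul M N y z = mmul N M y z" .
qed

subsection \<open>Primitive idempotents\<close>

lemma primitive_E: "k \<le> D \<Longrightarrow> primitive_idempotent Adj (E k)"
  using prim unfolding bij_betw_def by auto

lemma E_bose_mesner: "k \<le> D \<Longrightarrow> E k \<in> bose_mesner Adj"
  and E_nonzero: "k \<le> D \<Longrightarrow> E k \<noteq> (\<lambda>_ _. 0)"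
  and E_idem: "k \<le> D \<Longrightarrow> mmul (E k) (E k) = E k"
  using primitive_E unfolding primitive_idempotent_def by auto

lemma E_sym: "k \<le> D \<Longrightarrow> E k y z = E k z y"
  by (rule bose_mesner_sym[OF E_bose_mesner])

text \<open>The product is an idempotent lying under both \<open>E k\<close> and \<open>E l\<close>;
  if it were nonzero, primitivity would make it equal to each of them, against the injectivity of
  \<open>E\<close>.\<close>

lemma E_orthogonal:
  assumes k: "k \<le> D" and l: "l \<le> D" and "k \<noteq> l"
  shows "mmul (E k) (E l) = (\<lambda>_ _. 0)"
proof (rule ccontr)
  let ?F = "mmul (E k) (E l)"
  assume nz: "?F \<noteq> (\<lambda>_ _. 0)"
  have F: "?F \<in> bose_mesner Adj" by (intro bose_mesner_mmul E_bose_mesner k l)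
  have comm: "?F = mmul (E l) (E k)" by (intro bose_mesner_commute E_bose_mesner k l)
  have 1: "mmul (E k) ?F = ?F" by (metis mmul_assoc E_idem[OF k])
  have 2: "mmul (E l) ?F = ?F" by (metis comm mmul_assoc E_idem[OF l])
  have 3: "mmul ?F ?F = ?F" by (metis 1 2 mmul_assoc)
  have "?F = E k" using primitive_E[OF k] F 1 3 nz unfolding primitive_idempotent_def by blast
  moreover have "?F = E l" using primitive_E[OF l] F 2 3 nz unfolding primitive_idempotent_def by blast
  ultimately have "E k = E l" by simp
  then show False using prim k l \<open>k \<noteq> l\<close> unfolding bij_betw_def inj_on_def by auto
qed

lemma mapp_E_E:
  assumes "k \<le> D" "l \<le> D"
  shows "mapp (E k) (mapp (E l) v) = (if k = l then mapp (E k) v else (\<lambda>_. 0))"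
  using assms by (auto simp: mapp_mmul[symmetric] E_idem E_orthogonal) (simp add: mapp_def)

text \<open>The complex conjugate of a primitive idempotent is again one of the E l, and l = k since
  E k times its conjugate transpose is nonzero.\<close>

lemma E_real:
  assumes k: "k \<le> D"
  shows "cnj (E k y z) = E k y z"
proof -
  define cj :: "'a cmat \<Rightarrow> 'a cmat" where "cj = (\<lambda>M y z. cnj (M y z))"
  have cj_cj: "cj (cj M) = M" for M unfolding cj_def by simp
  have cj_mmul: "cj (mmul M N) = mmul (cj M) (cj N)" for M N
    unfolding cj_def mmul_def by simp
  have cj_0: "cj (\<lambda>_ _. 0) = (\<lambda>_ _. 0)" unfolding cj_def by simp
  have cj_bm: "cj M \<in> bose_mesner Adj" if M: "M \<in> bose_mesner Adj" for M
  proof -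
    obtain c where "M = (\<lambda>y z. c (d y z))" using M unfolding bose_mesner_iff by blast
    then have "cj M = (\<lambda>y z. cnj (c (d y z)))" unfolding cj_def by simp
    then show ?thesis unfolding bose_mesner_iff by (rule exI[of _ "\<lambda>h. cnj (c h)"])
  qed
  have "primitive_idempotent Adj (cj (E k))"
    unfolding primitive_idempotent_def
  proof (intro conjI ballI impI)
    show "cj (E k) \<in> bose_mesner Adj" by (intro cj_bm E_bose_mesner k)
    show "cj (E k) \<noteq> (\<lambda>_ _. 0)" by (metis E_nonzero[OF k] cj_0 cj_cj)
    show "mmul (cj (E k)) (cj (E k)) = cj (E k)" by (metis cj_mmul E_idem[OF k])
    fix F assume F: "F \<in> bose_mesner Adj" "mmul F F = F \<and> mmul (cj (E k)) F = F"
    have "cj F = (\<lambda>_ _. 0) \<or> cj F = E k"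
      using primitive_E[OF k] cj_bm[OF F(1)] F(2) unfolding primitive_idempotent_def
      by (metis cj_cj cj_mmul)
    then show "F = (\<lambda>_ _. 0) \<or> F = cj (E k)" by (metis cj_0 cj_cj)
  qed
  then obtain l where l: "l \<le> D" "cj (E k) = E l" using prim unfolding bij_betw_def by auto
  have "l = k"
  proof (rule ccontr)
    assume "l \<noteq> k"
    have "E k y = (\<lambda>_. 0)" for y
    proof (rule cinner_self_eq_0)
      have "cinner (E k y) (E k y) = mmul (E k) (cj (E k)) y y"
        unfolding cinner_def mmul_def cj_def by (simp add: E_sym[OF k, of _ y])
      then show "cinner (E k y) (E k y) = 0" using E_orthogonal[OF k l(1)] \<open>l \<noteq> k\<close> l(2) by simp
    qed
    then show False using E_nonzero[OF k] by auto
  qed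
  then show ?thesis using l(2) unfolding cj_def by metis
qed

lemma E_hermitian: "k \<le> D \<Longrightarrow> cnj (E k y z) = E k z y"
  using E_real E_sym by metis

text \<open>The E k are D + 1 independent elements of a space spanned by D + 1 matrices.\<close>

lemma bose_mesner_span_E:
  assumes "M \<in> bose_mesner Adj"
  obtains c where "M = (\<lambda>y z. \<Sum>k\<le>D. c k * E k y z)"
proof -
  obtain m where m: "\<And>k. k \<le> D \<Longrightarrow> E k = (\<lambda>y z. \<Sum>i\<le>D. m k i * distmat Adj i y z)"
    using E_bose_mesner unfolding bose_mesner_def by simp metis
  have ex: "\<exists>c. distmat Adj i = (\<lambda>y z. \<Sum>k\<le>D. c k * E k y z)" if i: "i \<le> D" for i
  proof -
    have "\<exists>c. (\<lambda>(y, z). distmat Adj i y z) = (\<lambda>p. \<Sum>k\<le>D. c k * (\<lambda>(y, z). E k y z) p)"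
    proof (rule exchange_spanning_family[where m = m and C = "\<lambda>i (y, z). distmat Adj i y z"])
      fix k assume "k \<le> D"
      then show "(\<lambda>(y, z). E k y z) = (\<lambda>p. \<Sum>i\<le>D. m k i * (case p of (y, z) \<Rightarrow> distmat Adj i y z))"
        by (auto simp: m fun_eq_iff)
    next
      fix c assume sum0: "\<And>p. (\<Sum>k\<le>D. c k * (case p of (y, z) \<Rightarrow> E k y z)) = 0"
      show "\<forall>k\<le>D. c k = 0"
      proof (intro allI impI)
        fix l assume l: "l \<le> D"
        have "(\<lambda>y z. \<Sum>k\<le>D. c k * E k y z) = (\<lambda>_ _. 0)" using sum0[of "(_, _)"] by (intro ext) simp
        then have "mmul (E l) (\<lambda>y z. \<Sum>k\<le>D. c k * E k y z) = (\<lambda>_ _. 0)" by (simp add: mmul_def)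
        moreover have "mmul (E l) (\<lambda>y z. \<Sum>k\<le>D. c k * E k y z) = (\<lambda>y z. c l * E l y z)"
          unfolding mmul_sum_right
        proof (intro ext)
          fix y z
          have "(\<Sum>k\<le>D. c k * mmul (E l) (E k) y z) = (\<Sum>k\<le>D. if k = l then c l * E l y z else 0)"
            using l by (intro sum.cong) (auto simp: E_idem E_orthogonal)
          then show "(\<Sum>k\<le>D. c k * mmul (E l) (E k) y z) = c l * E l y z" using l by simp
        qed
        ultimately show "c l = 0" using E_nonzero[OF l] by (metis mult_eq_0_iff ext)
      qed
    qed (rule i)
    then show ?thesis by (auto simp: fun_eq_iff)
  qed
  then obtain a where a: "\<And>i. i \<le> D \<Longrightarrow> distmat Adj i = (\<lambda>y z. \<Sum>k\<le>D. a i k * E k y z)"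
    by metis
  obtain c where c: "M = (\<lambda>y z. \<Sum>i\<le>D. c i * distmat Adj i y z)"
    using assms unfolding bose_mesner_def by blast
  have "M = (\<lambda>y z. \<Sum>k\<le>D. (\<Sum>i\<le>D. c i * a i k) * E k y z)"
  proof (intro ext)
    fix y z
    have "M y z = (\<Sum>i\<le>D. c i * (\<Sum>k\<le>D. a i k * E k y z))" unfolding c by (simp add: a)
    also have "\<dots> = (\<Sum>k\<le>D. (\<Sum>i\<le>D. c i * a i k) * E k y z)"
      by (simp add: sum_distrib_left sum_distrib_right mult.assoc) (rule sum.swap)
    finally show "M y z = (\<Sum>k\<le>D. (\<Sum>i\<le>D. c i * a i k) * E k y z)" .
  qed
  then show ?thesis by (rule that)
qed

lemma sum_E:
  "v = (\<lambda>y. \<Sum>k\<le>D. mapp (E k) v y)"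
proof -
  have "idm = (\<lambda>y z. (if d y z = 0 then 1 else 0 :: complex))" unfolding idm_def dist_eq_0 ..
  then have "idm \<in> bose_mesner Adj"
    unfolding bose_mesner_iff by (intro exI[of _ "\<lambda>h. if h = 0 then 1 else 0"])
  then obtain c where c: "idm = (\<lambda>y z. \<Sum>k\<le>D. c k * E k y z)" by (rule bose_mesner_span_E)
  have v: "v = (\<lambda>y. \<Sum>k\<le>D. c k * mapp (E k) v y)" for v
    using mapp_mat_sum[of c E "{..D}" v] c mapp_idm by metis
  \<comment> \<open>On a vector in the image of \<open>E l\<close> the expansion of the identity has
    one surviving term, so \<open>c l\<close> acts as 1 there.\<close>
  have cl: "c l * mapp (E l) v y = mapp (E l) v y" if l: "l \<le> D" for l y
  proof -
    have "mapp (E l) v y = (\<Sum>k\<le>D. c k * mapp (E k) (mapp (E l) v) y)"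
      using fun_cong[OF v[of "mapp (E l) v"]] .
    also have "\<dots> = (\<Sum>k\<le>D. if k = l then c l * mapp (E l) v y else 0)"
      using l by (intro sum.cong) (auto simp: mapp_E_E)
    finally show ?thesis using l by simp
  qed
  have "(\<Sum>k\<le>D. c k * mapp (E k) v y) = (\<Sum>k\<le>D. mapp (E k) v y)" for y
    by (intro sum.cong refl cl) simp
  then show ?thesis using v[of v] by simp
qed

lemma eq_0_if_E_eq_0:
  assumes "\<And>k. k \<le> D \<Longrightarrow> mapp (E k) v = (\<lambda>_. 0)"
  shows "v = (\<lambda>_. 0)"
  by (subst sum_E) (simp add: assms)

lemma mapp_E_A: assumes h: "h \<le> D" shows "mapp (E h) (mapp A v) = (\<lambda>y. \<theta> h * mapp (E h) v y)"
proof -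
  have "mapp A v = (\<lambda>y. \<Sum>k\<le>D. \<theta> k * mapp (E k) v y)" unfolding eig mapp_mat_sum ..
  then have "mapp (E h) (mapp A v) = (\<lambda>y. \<Sum>k\<le>D. \<theta> k * mapp (E h) (mapp (E k) v) y)"
    by (simp add: mapp_sum mapp_scale)
  also have "\<dots> = (\<lambda>y. \<Sum>k\<le>D. if k = h then \<theta> h * mapp (E h) v y else 0)"
    using h by (intro ext sum.cong) (auto simp: mapp_E_E)
  finally show ?thesis using h by simp
qed

lemma A_hermitian: "cnj (A y z) = A z y"
  unfolding adjmat_def using Adj_sym by auto

subsection \<open>Krein parameters and the dual adjacency matrix\<close>

definition krein :: "nat \<Rightarrow> nat \<Rightarrow> nat \<Rightarrow> complex" where
  "krein = (SOME q.
     (\<forall>i\<le>D. \<forall>j\<le>D. hadamard (E i) (E j) =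
        (\<lambda>y z. (1 / of_nat (card (UNIV::'a set))) * (\<Sum>h\<le>D. q h i j * E h y z))) \<and>
     (\<forall>h\<le>D. \<forall>i\<le>D. \<forall>j\<le>D.
        ((h > i + j \<or> i > h + j \<or> j > h + i) \<longrightarrow> q h i j = 0) \<and>
        ((h = i + j \<or> i = h + j \<or> j = h + i) \<longrightarrow> q h i j \<noteq> 0)))"

lemma krein_hadamard:
    "i \<le> D \<Longrightarrow> j \<le> D \<Longrightarrow> E i y z * E j y z =
       (1 / of_nat (card (UNIV::'a set))) * (\<Sum>h\<le>D. krein h i j * E h y z)" (is "_ \<Longrightarrow> _ \<Longrightarrow> ?H")
  and krein_eq_0: "h \<le> D \<Longrightarrow> i \<le> D \<Longrightarrow> j \<le> D \<Longrightarrow>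
       h > i + j \<or> i > h + j \<or> j > h + i \<Longrightarrow> krein h i j = 0"
  and krein_neq_0: "h \<le> D \<Longrightarrow> i \<le> D \<Longrightarrow> j \<le> D \<Longrightarrow>
       h = i + j \<or> i = h + j \<or> j = h + i \<Longrightarrow> krein h i j \<noteq> 0"
proof -
  note * = someI_ex[OF qpoly[unfolded Q_polynomial_def], folded krein_def]
  show "?H" if "i \<le> D" "j \<le> D"
    using * that unfolding hadamard_def by (metis (no_types, lifting))
  show "h \<le> D \<Longrightarrow> i \<le> D \<Longrightarrow> j \<le> D \<Longrightarrow>
       h > i + j \<or> i > h + j \<or> j > h + i \<Longrightarrow> krein h i j = 0" using * by blast
  show "h \<le> D \<Longrightarrow> i \<le> D \<Longrightarrow> j \<le> D \<Longrightarrow>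
       h = i + j \<or> i = h + j \<or> j = h + i \<Longrightarrow> krein h i j \<noteq> 0" using * by blast
qed

lemma card_X: "of_nat (card (UNIV::'a set)) \<noteq> (0::complex)"
  by simp

text \<open>As \<open>krein h 0 k\<close> vanishes unless h = k, the entrywise product of
  \<open>E 0\<close> with \<open>E k\<close> is a nonzero multiple of \<open>E k\<close>. Every
  entry is nonzero in some \<open>E k\<close>, because the all-ones matrix is a combination of them;
  hence no entry of \<open>E 0\<close> vanishes, and the case k = 0 can be cancelled to show that
  all entries agree.\<close>

lemma E_0_constant: "\<exists>c. c \<noteq> 0 \<and> (\<forall>y z. E 0 y z = c)"
proof -
  have nz: "E 0 y z \<noteq> 0" for y z
  proof -
    have "(\<lambda>_ _. 1) \<in> bose_mesner Adj" unfolding bose_mesner_iff by (rule exI[of _ "\<lambda>_. 1"]) simp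
    then obtain c where c: "(\<lambda>_ _. 1 :: complex) = (\<lambda>y z. \<Sum>k\<le>D. c k * E k y z)"
      by (rule bose_mesner_span_E)
    have "(\<Sum>k\<le>D. c k * E k y z) \<noteq> 0" using fun_cong[OF fun_cong[OF c], of y z] by simp
    then obtain k where k: "k \<le> D" "E k y z \<noteq> 0"
      by (auto elim: sum.not_neutral_contains_not_neutral)
    have "(\<Sum>h\<le>D. krein h 0 k * E h y z) = (\<Sum>h\<le>D. if h = k then krein k 0 k * E k y z else 0)"
    proof (intro sum.cong refl)
      fix h assume "h \<in> {..D}"
      then show "krein h 0 k * E h y z = (if h = k then krein k 0 k * E k y z else 0)"
        using krein_eq_0[of h 0 k] k(1) by (cases h k rule: linorder_cases) auto
    qed
    then have "E 0 y z * E k y z = (1 / of_nat (card (UNIV::'a set))) * (krein k 0 k * E k y z)"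
      using krein_hadamard[of 0 k y z] k(1) by simp
    then have "E 0 y z * E k y z \<noteq> 0" using k krein_neq_0[of k 0 k] card_X by simp
    then show ?thesis by simp
  qed
  have "E 0 y z = krein 0 0 0 / of_nat (card (UNIV::'a set))" for y z
  proof -
    have "(\<Sum>h\<le>D. krein h 0 0 * E h y z) = (\<Sum>h\<le>D. if h = 0 then krein 0 0 0 * E 0 y z else 0)"
      by (intro sum.cong) (auto simp: krein_eq_0)
    then have "E 0 y z * E 0 y z = (1 / of_nat (card (UNIV::'a set))) * (krein 0 0 0 * E 0 y z)"
      using krein_hadamard[of 0 0 y z] by simp
    then have "E 0 y z * E 0 y z = (krein 0 0 0 / of_nat (card (UNIV::'a set))) * E 0 y z" by simp
    then show ?thesis using nz[of y z] mult_right_cancel by blast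
  qed
  then show ?thesis using nz by metis
qed

lemma Astar_apply: "mapp Astar v y = of_nat (card (UNIV::'a set)) * E 1 x y * v y"
  unfolding mapp_def dual_adj_def by (simp add: if_distrib[of "\<lambda>t. t * _"] cong: if_cong)

lemma Astar_eigenvalue: "of_nat (card (UNIV::'a set)) * E 1 x y = \<theta>s (d x y)"
proof -
  have "of_nat (card (UNIV::'a set)) * E 1 x y = Astar y y" unfolding dual_adj_def by simp
  also have "\<dots> = (\<Sum>k\<le>D. if k = d x y then \<theta>s (d x y) else 0)"
    unfolding dualeig dual_idem_def by (intro sum.cong) auto
  finally show ?thesis using dist_le_diameter by simp
qed

lemma Astar_hermitian: "cnj (Astar y z) = Astar z y"
  unfolding dual_adj_def using E_real[OF diam] by auto

text \<open>The sum over z of the squared norms of E h A* E j e_z equals |X| q^1_hj (E 1)_xx.\<close>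

lemma E_Astar_E_eq_0:
  assumes h: "h \<le> D" and hj: "h > Suc j"
  shows "mapp (E h) (mapp Astar (mapp (E j) v)) = (\<lambda>_. 0)"
proof -
  have j: "j \<le> D" using h hj by simp
  define N :: complex where "N = of_nat (card (UNIV::'a set))"
  define e where "e z = (\<lambda>w. E j w z)" for z
  define u where "u z = mapp (E h) (mapp Astar (e z))" for z
  define a where "a w = N * E 1 x w" for w
  have cnj_a: "cnj (a w) = a w" for w unfolding a_def N_def using E_real[OF diam] by simp
  have "cinner (u z) (u z) = (\<Sum>w\<in>UNIV. \<Sum>w'\<in>UNIV. a w * a w' * E h w w' * (E j w z * E j z w'))" for z
  proof -
    have "cinner (u z) (u z) = cinner (mapp Astar (e z)) (mapp (E h) (u z))"
      unfolding u_def by (rule cinner_mapp_hermitian[OF E_hermitian[OF h]])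
    also have "mapp (E h) (u z) = mapp (E h) (mapp Astar (e z))"
      unfolding u_def using mapp_E_E[OF h h] by simp
    also have "cinner (mapp Astar (e z)) \<dots> =
        (\<Sum>w\<in>UNIV. a w * E j w z * (\<Sum>w'\<in>UNIV. E h w w' * (a w' * E j z w')))"
      unfolding cinner_def Astar_apply mapp_def[of "E h"] e_def a_def[symmetric] N_def[symmetric]
      by (simp add: cnj_a E_real[OF h] E_real[OF j] E_sym[OF j, of _ z])
    also have "\<dots> = (\<Sum>w\<in>UNIV. \<Sum>w'\<in>UNIV. a w * a w' * E h w w' * (E j w z * E j z w'))"
      by (simp add: sum_distrib_left mult_ac)
    finally show ?thesis .
  qed
  then have "(\<Sum>z\<in>UNIV. cinner (u z) (u z)) =
      (\<Sum>z\<in>UNIV. \<Sum>w\<in>UNIV. \<Sum>w'\<in>UNIV. a w * a w' * E h w w' * (E j w z * E j z w'))" by simp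
  \<comment> \<open>Summing over \<open>z\<close> contracts the two factors \<open>E j\<close> into
    one by idempotency; its entrywise product with \<open>E h\<close> is then expanded by Krein
    parameters.\<close>
  also have "\<dots> = (\<Sum>w\<in>UNIV. \<Sum>w'\<in>UNIV. a w * a w' * E h w w' * (\<Sum>z\<in>UNIV. E j w z * E j z w'))"
    unfolding sum_distrib_left by (subst sum.swap) (intro sum.cong refl sum.swap)
  also have "\<dots> = (\<Sum>w\<in>UNIV. \<Sum>w'\<in>UNIV. a w * a w' * (E h w w' * E j w w'))"
    using E_idem[OF j] unfolding mmul_def by (simp add: fun_eq_iff mult.assoc)
  also have "\<dots> = (\<Sum>w\<in>UNIV. \<Sum>w'\<in>UNIV. \<Sum>r\<le>D. N * krein r h j * (E 1 x w * (E r w w' * E 1 w' x)))"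
    unfolding krein_hadamard[OF h j] a_def N_def using E_sym[OF diam, of x]
    by (simp add: sum_distrib_left mult_ac)
  also have "\<dots> = (\<Sum>r\<le>D. \<Sum>w\<in>UNIV. \<Sum>w'\<in>UNIV. N * krein r h j * (E 1 x w * (E r w w' * E 1 w' x)))"
    by (subst sum.swap[of _ "{..D}"], intro sum.cong refl sum.swap)
  also have "\<dots> = (\<Sum>r\<le>D. N * krein r h j * mmul (E 1) (mmul (E r) (E 1)) x x)"
    unfolding mmul_def by (simp add: sum_distrib_left)
  also have "\<dots> = 0"
  proof (rule sum.neutral, safe)
    fix r assume r: "r \<le> D"
    \<comment> \<open>Orthogonality to \<open>E 1\<close> leaves only r = 1, and
      \<open>krein 1 h j\<close> vanishes because h > 1 + j.\<close>
    show "N * krein r h j * mmul (E 1) (mmul (E r) (E 1)) x x = 0"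
    proof (cases "r = 1")
      case True
      then show ?thesis using krein_eq_0[OF diam h j] hj by simp
    next
      case False
      then show ?thesis using E_orthogonal[OF r diam] by (simp add: mmul_def)
    qed
  qed
  finally have sum0: "(\<Sum>z\<in>UNIV. cinner (u z) (u z)) = 0" .
  have u0: "u z = (\<lambda>_. 0)" for z
  proof -
    have "complex_of_real (\<Sum>z\<in>UNIV. \<Sum>y\<in>UNIV. (cmod (u z y))\<^sup>2) = 0"
      using sum0 unfolding cinner_self of_real_sum .
    then have "(\<Sum>z\<in>UNIV. \<Sum>y\<in>UNIV. (cmod (u z y))\<^sup>2) = 0" by (metis of_real_eq_0_iff)
    then have "(\<Sum>y\<in>UNIV. (cmod (u z y))\<^sup>2) = 0"
      by (subst (asm) sum_nonneg_eq_0_iff) (auto intro: sum_nonneg)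
    then show ?thesis using cinner_self[of "u z"] by (intro cinner_self_eq_0) simp
  qed
  have "mapp (E j) v = (\<lambda>w. \<Sum>z\<in>UNIV. v z * e z w)"
    unfolding mapp_def e_def by (simp add: mult.commute)
  then have "mapp (E h) (mapp Astar (mapp (E j) v)) = (\<lambda>y. \<Sum>z\<in>UNIV. v z * u z y)"
    unfolding u_def by (simp add: mapp_sum mapp_scale)
  then show ?thesis by (simp add: u0)
qed

text \<open>Only components \<open>E k v\<close> with k at most j are present, and each of them
  satisfies h > k + 1. This is the counterpart of \<open>dist_step\<close> for the ordering of the
  idempotents.\<close>

lemma E_Astar_eq_0:
  assumes h: "h \<le> D" "h > Suc j" and v: "\<And>k. j < k \<Longrightarrow> k \<le> D \<Longrightarrow> mapp (E k) v = (\<lambda>_. 0)"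
  shows "mapp (E h) (mapp Astar v) = (\<lambda>_. 0)"
proof -
  have "mapp (E h) (mapp Astar v) = mapp (E h) (mapp Astar (\<lambda>y. \<Sum>k\<le>D. mapp (E k) v y))"
    using sum_E[of v] by simp
  also have "\<dots> = (\<lambda>y. \<Sum>k\<le>D. mapp (E h) (mapp Astar (mapp (E k) v)) y)"
    unfolding mapp_sum ..
  also have "\<dots> = (\<lambda>_. 0)"
  proof (intro ext sum.neutral ballI)
    fix y k assume k: "k \<in> {..D}"
    show "mapp (E h) (mapp Astar (mapp (E k) v)) y = 0"
    proof (cases "j < k")
      case True then show ?thesis using v[of k] k by (simp add: mapp_zero)
    next
      case False then show ?thesis using E_Astar_E_eq_0[of h k] h by simp
    qed
  qed
  finally show ?thesis .
qed

subsection \<open>Invariant subspaces\<close>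

text \<open>Each distance matrix is a polynomial in A.\<close>

lemma A_invariant_distmat:
  assumes S: "cvec_subspace S" and inv: "\<And>v. v \<in> S \<Longrightarrow> mapp A v \<in> S" and "v \<in> S"
  shows "mapp (distmat Adj i) v \<in> S"
proof (induction i rule: less_induct)
  case (less i)
  show ?case
  proof (cases i)
    case 0
    have "distmat Adj 0 = idm" unfolding distmat_def idm_def dist_eq_0 ..
    then show ?thesis using 0 \<open>v \<in> S\<close> by (simp add: mapp_idm)
  next
    case (Suc n)
    show ?thesis
    proof (cases "\<exists>y z. d y z = i")
      \<comment> \<open>The top coefficient below is seen to be nonzero at an actual pair at
        distance \<open>i\<close>, so an empty distance class is set aside.\<close>
      case False
      then have "mapp (distmat Adj i) v = (\<lambda>_. 0)" unfolding distmat_def mapp_def by simp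
      then show ?thesis using cvec_subspace_zero[OF S] by simp
    next
      case True
      \<comment> \<open>\<open>?p h\<close> is the coefficient of \<open>distmat Adj h\<close> in
        the product of \<open>A\<close> with \<open>distmat Adj n\<close>. The triangle inequality
        cuts the expansion off at h = i, and a predecessor on a shortest path makes
        \<open>?p i\<close> nonzero, so the top term can be solved for.\<close>
      let ?p = "\<lambda>h. of_nat (intersection_number h 1 n) :: complex"
      have p0: "intersection_number (d y z) 1 n = 0" if "d y z > i" for y z
      proof -
        have "{w. d y w = 1 \<and> d z w = n} = {}"
        proof safe
          fix w assume w: "d y w = 1" "n = d z w"
          then have "d z y \<le> Suc (d z w)" using dist_eq_1 Adj_sym dist_step by blast
          then show "w \<in> {}" using that Suc w dist_sym[of y z] by simp
        qed
        then show ?thesis using card_intersection[of y 1 z n] by (metis card.empty)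
      qed
      have pi: "?p i \<noteq> 0"
      proof -
        obtain y z where yz: "d y z = i" using True by blast
        then have "d z y = Suc n" using Suc dist_sym by metis
        then obtain w where "d z w = n" "Adj w y" by (rule dist_predecessor)
        then have "w \<in> {w. d y w = 1 \<and> d z w = n}" using dist_eq_1 Adj_sym by blast
        then have "card {w. d y w = 1 \<and> d z w = n} \<noteq> 0" by auto
        then show ?thesis using card_intersection[of y 1 z n] yz by (metis of_nat_eq_0_iff)
      qed
      have prod: "mmul A (distmat Adj n) = (\<lambda>y z. \<Sum>h\<le>i. ?p h * distmat Adj h y z)"
        unfolding adjmat_distmat mmul_distmat
      proof (intro ext)
        fix y z
        have "(\<Sum>h\<le>i. ?p h * distmat Adj h y z) = (\<Sum>h\<le>i. if h = d y z then ?p (d y z) else 0)"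
          unfolding distmat_def by (intro sum.cong) auto
        then show "?p (d y z) = (\<Sum>h\<le>i. ?p h * distmat Adj h y z)"
          using p0[of y z] by (auto simp: not_le)
      qed
      have "mapp A (mapp (distmat Adj n) v) = (\<lambda>y. \<Sum>h\<le>i. ?p h * mapp (distmat Adj h) v y)"
        unfolding mapp_mmul[symmetric] prod mapp_mat_sum ..
      then have eq: "mapp (distmat Adj i) v y = (1 / ?p i) *
          (mapp A (mapp (distmat Adj n) v) y - (\<Sum>h\<le>n. ?p h * mapp (distmat Adj h) v y))" for y
        using pi by (simp add: Suc)
      show ?thesis
        unfolding eq
        by (intro cvec_subspace_scale[OF S] cvec_subspace_diff[OF S] cvec_subspace_sum[OF S] inv less.IH)
          (auto simp: Suc)
    qed
  qed
qed

lemma A_invariant_E: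
  assumes S: "cvec_subspace S" and inv: "\<And>v. v \<in> S \<Longrightarrow> mapp A v \<in> S" and v: "v \<in> S" and k: "k \<le> D"
  shows "mapp (E k) v \<in> S"
proof -
  obtain c where c: "E k = (\<lambda>y z. \<Sum>i\<le>D. c i * distmat Adj i y z)"
    using E_bose_mesner[OF k] unfolding bose_mesner_def by blast
  have "mapp (E k) v = (\<lambda>y. \<Sum>i\<le>D. c i * mapp (distmat Adj i) v y)"
    unfolding c mapp_mat_sum ..
  also have "\<dots> \<in> S"
    by (intro cvec_subspace_sum[OF S] cvec_subspace_scale[OF S] A_invariant_distmat[OF S inv v]) auto
  finally show ?thesis .
qed

text \<open>Dually, each dual distance matrix diag((E k)_xy) is a polynomial in A*.\<close>

lemma Astar_invariant_E_row:
  assumes S: "cvec_subspace S" and inv: "\<And>v. v \<in> S \<Longrightarrow> mapp Astar v \<in> S" and "v \<in> S"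
  shows "k \<le> D \<Longrightarrow> (\<lambda>y. E k x y * v y) \<in> S"
proof (induction k rule: less_induct)
  case (less k)
  show ?case
  proof (cases k)
    case 0
    obtain c where "\<And>y z. E 0 y z = c" using E_0_constant by blast
    then show ?thesis using 0 cvec_subspace_scale[OF S \<open>v \<in> S\<close>] by simp
  next
    case (Suc n)
    \<comment> \<open>\<open>A*\<close> multiplies entrywise by |X| times row \<open>x\<close> of
      \<open>E 1\<close>, so \<open>?q h\<close> is the coefficient of row \<open>x\<close> of
      \<open>E h\<close> when it is applied to row \<open>x\<close> of \<open>E n\<close>. It
      vanishes for h > n + 1 = k and is nonzero at h = k.\<close>
    let ?q = "\<lambda>h. krein h 1 n"
    have qk: "?q k \<noteq> 0" using krein_neq_0[of k 1 n] less.prems diam Suc by simp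
    have eq: "E k x y * v y = (1 / ?q k) *
        (mapp Astar (\<lambda>y. E n x y * v y) y - (\<Sum>h\<le>n. ?q h * (E h x y * v y)))" for y
    proof -
      have "(\<Sum>h\<le>D. ?q h * E h x y) = (\<Sum>h\<le>k. ?q h * E h x y)"
        using less.prems diam Suc by (intro sum.mono_neutral_right) (auto simp: krein_eq_0)
      then have "of_nat (card (UNIV::'a set)) * (E 1 x y * E n x y) = (\<Sum>h\<le>k. ?q h * E h x y)"
        using krein_hadamard[of 1 n x y] less.prems diam Suc by simp
      then have "mapp Astar (\<lambda>y. E n x y * v y) y = (\<Sum>h\<le>k. ?q h * E h x y) * v y"
        unfolding Astar_apply by (simp add: mult.assoc[symmetric])
      then have "mapp Astar (\<lambda>y. E n x y * v y) y = (\<Sum>h\<le>k. ?q h * (E h x y * v y))"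
        by (simp add: sum_distrib_right mult.assoc)
      then show ?thesis using qk by (simp add: Suc)
    qed
    show ?thesis
      unfolding eq
      by (intro cvec_subspace_scale[OF S] cvec_subspace_diff[OF S] cvec_subspace_sum[OF S] inv less.IH)
        (use less.prems in \<open>auto simp: Suc\<close>)
  qed
qed

lemma mapp_dual_idem: "mapp (dual_idem Adj x i) v = (\<lambda>y. if d x y = i then v y else 0)"
proof
  fix y
  have "mapp (dual_idem Adj x i) v y =
      (\<Sum>w\<in>UNIV. if w = y then (if d x y = i then v y else 0) else 0)"
    unfolding mapp_def dual_idem_def by (intro sum.cong) auto
  then show "mapp (dual_idem Adj x i) v y = (if d x y = i then v y else 0)" by simp
qed

text \<open>\<open>E*_i\<close> is the diagonal matrix made from row \<open>x\<close> of the i-th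
  distance matrix, which is a combination of the \<open>E k\<close>; the diagonal matrices of their
  rows preserve \<open>S\<close> already.\<close>

lemma Astar_invariant_dual_idem:
  assumes S: "cvec_subspace S" and inv: "\<And>v. v \<in> S \<Longrightarrow> mapp Astar v \<in> S" and v: "v \<in> S"
  shows "mapp (dual_idem Adj x i) v \<in> S"
proof -
  have "distmat Adj i \<in> bose_mesner Adj"
    unfolding bose_mesner_iff distmat_def by (rule exI[of _ "\<lambda>h. if h = i then 1 else 0"]) simp
  then obtain c where c: "distmat Adj i = (\<lambda>y z. \<Sum>k\<le>D. c k * E k y z)"
    by (rule bose_mesner_span_E)
  have "mapp (dual_idem Adj x i) v = (\<lambda>y. distmat Adj i x y * v y)"
    unfolding mapp_dual_idem distmat_def by auto
  also have "\<dots> = (\<lambda>y. \<Sum>k\<le>D. c k * (E k x y * v y))"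
    unfolding c by (simp add: sum_distrib_right mult.assoc)
  also have "\<dots> \<in> S"
    by (intro cvec_subspace_sum[OF S] cvec_subspace_scale[OF S] Astar_invariant_E_row[OF S inv v]) auto
  finally show ?thesis .
qed

subsection \<open>The spaces V_ij and their antidiagonal sums\<close>

text \<open>This is V_ij for i, j at most D; the description by vanishing components also makes sense
  for larger indices, where sum_images would involve junk values E k with k > D.\<close>

definition corner :: "nat \<Rightarrow> nat \<Rightarrow> 'a cvec set" where
  "corner i j = {v. (\<forall>y. i < d x y \<longrightarrow> v y = 0) \<and>
     (\<forall>k. j < k \<and> k \<le> D \<longrightarrow> mapp (E k) v = (\<lambda>_. 0))}"

lemma sum_images_dual_idem: "sum_images (dual_idem Adj x) n = {v. \<forall>y. n < d x y \<longrightarrow> v y = 0}"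
proof -
  have sum: "(\<Sum>k\<le>n. mapp (dual_idem Adj x k) (w k) y) = (if d x y \<le> n then w (d x y) y else 0)" for w y
    unfolding mapp_dual_idem by simp
  show ?thesis
  proof safe
    fix v y assume "v \<in> sum_images (dual_idem Adj x) n" "n < d x y"
    then show "v y = 0" unfolding sum_images_def sum by auto
  next
    fix v :: "'a cvec" assume "\<forall>y. n < d x y \<longrightarrow> v y = 0"
    then have "v = (\<lambda>y. if d x y \<le> n then v y else 0)" by (auto simp: not_le)
    then show "v \<in> sum_images (dual_idem Adj x) n"
      unfolding sum_images_def sum by (intro CollectI exI[of _ "\<lambda>_. v"])
  qed
qed

text \<open>Orthogonality of the \<open>E k\<close> gives one inclusion, completeness the other. The
  kernel form is the one that Hermitian operators can test.\<close>

lemma sum_images_E: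
  assumes n: "n \<le> D"
  shows "sum_images E n = {v. \<forall>k. n < k \<and> k \<le> D \<longrightarrow> mapp (E k) v = (\<lambda>_. 0)}" (is "_ = ?R")
proof safe
  fix v k assume "v \<in> sum_images E n" and k: "n < k" "k \<le> D"
  then obtain w where "v = (\<lambda>y. \<Sum>l\<le>n. mapp (E l) (w l) y)" unfolding sum_images_def by blast
  then have "mapp (E k) v = (\<lambda>y. \<Sum>l\<le>n. mapp (E k) (mapp (E l) (w l)) y)" by (simp add: mapp_sum)
  also have "\<dots> = (\<lambda>_. 0)" using k by (intro ext sum.neutral) (auto simp: mapp_E_E)
  finally show "mapp (E k) v = (\<lambda>_. 0)" .
next
  fix v assume v: "\<forall>k. n < k \<and> k \<le> D \<longrightarrow> mapp (E k) v = (\<lambda>_. 0)"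
  have "(\<Sum>k\<le>D. mapp (E k) v y) = (\<Sum>k\<le>n. mapp (E k) v y)" for y
    using v n by (intro sum.mono_neutral_right) auto
  then have "v = (\<lambda>y. \<Sum>k\<le>n. mapp (E k) v y)" using sum_E[of v] by simp
  then show "v \<in> sum_images E n" unfolding sum_images_def by (auto intro!: exI[of _ "\<lambda>_. v"])
qed

lemma Vsp_corner: "j \<le> D \<Longrightarrow> Vsp Adj E x (int i) (int j) = corner i j"
  unfolding Vsp_def corner_def by (auto simp: sum_images_dual_idem sum_images_E)

lemma cvec_subspace_corner: "cvec_subspace (corner i j)"
  unfolding cvec_subspace_def corner_def by (simp add: mapp_zero mapp_add mapp_scale)

text \<open>No distance and no idempotent index exceeds \<open>D\<close>, so larger indices impose
  no condition. This matters when a map pushes an index to D + 1.\<close>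

lemma corner_diameter: "D \<le> i \<Longrightarrow> corner i j = corner D j" "D \<le> j \<Longrightarrow> corner i j = corner i D"
proof -
  show "corner i j = corner D j" if "D \<le> i"
    unfolding corner_def using that dist_le_diameter[of x] by (meson leD order_trans)
  show "corner i j = corner i D" if "D \<le> j"
    unfolding corner_def using that by auto
qed

section \<open>Action of the two shifted operators on the corners\<close>

lemma A_corner_zero:
  assumes "v \<in> corner i 0"
  shows "(\<lambda>y. mapp A v y + - \<theta> 0 * v y) = (\<lambda>_. 0)"
proof (rule eq_0_if_E_eq_0)
  fix k assume k: "k \<le> D"
  show "mapp (E k) (\<lambda>y. mapp A v y + - \<theta> 0 * v y) = (\<lambda>_. 0)"
    unfolding mapp_add mapp_scale mapp_E_A[OF k]
    using assms k by (cases "k = 0") (auto simp: corner_def)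
qed

text \<open>An edge changes the distance to \<open>x\<close> by at most one, so the support grows by
  at most one sphere, while subtracting \<open>\<theta> (Suc j)\<close> removes the component in the
  top eigenspace.\<close>

lemma A_corner:
  assumes v: "v \<in> corner i (Suc j)"
  shows "(\<lambda>y. mapp A v y + - \<theta> (Suc j) * v y) \<in> corner (Suc i) j"
  unfolding corner_def
proof (safe)
  fix y assume y: "Suc i < d x y"
  have "A y w * v w = 0" for w
  proof (cases "Adj y w")
    case True
    then have "d x y \<le> Suc (d x w)" using Adj_sym dist_step by blast
    then show ?thesis using y v by (simp add: corner_def)
  qed (simp add: adjmat_def)
  then have "mapp A v y = 0" unfolding mapp_def by (intro sum.neutral) simp
  then show "mapp A v y + - \<theta> (Suc j) * v y = 0" using y v by (simp add: corner_def)
next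
  fix k assume k: "j < k" "k \<le> D"
  show "mapp (E k) (\<lambda>y. mapp A v y + - \<theta> (Suc j) * v y) = (\<lambda>_. 0)"
    unfolding mapp_add mapp_scale mapp_E_A[OF k(2)]
    using v k by (cases "k = Suc j") (auto simp: corner_def)
qed

lemma Astar_apply_eigenvalue: "mapp Astar v y = \<theta>s (d x y) * v y"
  unfolding Astar_apply Astar_eigenvalue ..

lemma Astar_corner_zero:
  assumes "v \<in> corner 0 j"
  shows "(\<lambda>y. mapp Astar v y + - \<theta>s 0 * v y) = (\<lambda>_. 0)"
proof
  fix y show "mapp Astar v y + - \<theta>s 0 * v y = 0"
    using assms by (cases "d x y = 0") (auto simp: corner_def Astar_apply_eigenvalue)
qed

text \<open>Dually, subtracting \<open>\<theta>s (Suc i)\<close> clears the outermost sphere, and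
  \<open>E_Astar_eq_0\<close> bounds the growth along the idempotents by one step.\<close>

lemma Astar_corner:
  assumes v: "v \<in> corner (Suc i) j"
  shows "(\<lambda>y. mapp Astar v y + - \<theta>s (Suc i) * v y) \<in> corner i (Suc j)"
  unfolding corner_def
proof (safe)
  fix y assume y: "i < d x y"
  show "mapp Astar v y + - \<theta>s (Suc i) * v y = 0"
    using v y by (cases "d x y = Suc i") (auto simp: corner_def Astar_apply_eigenvalue)
next
  fix k assume k: "Suc j < k" "k \<le> D"
  show "mapp (E k) (\<lambda>y. mapp Astar v y + - \<theta>s (Suc i) * v y) = (\<lambda>_. 0)"
    unfolding mapp_add mapp_scale
    using v k E_Astar_eq_0[of k j v] by (simp add: corner_def)
qed

text \<open>The S_n of the overview, for every n: as the indices of \<open>corner\<close> are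
  unbounded, k runs from 0 to n without truncation at \<open>D\<close>.\<close>

definition antidiag :: "nat \<Rightarrow> 'a cvec set" where
  "antidiag n = {v. \<exists>w. (\<forall>k\<le>n. w k \<in> corner k (n - k)) \<and> v = (\<lambda>y. \<Sum>k\<le>n. w k y)}"

lemma cvec_subspace_antidiag: "cvec_subspace (antidiag n)"
  unfolding cvec_subspace_def
proof (intro conjI ballI allI)
  show "(\<lambda>_. 0) \<in> antidiag n"
    unfolding antidiag_def
    by (auto intro!: exI[of _ "\<lambda>_ _. 0"] cvec_subspace_zero[OF cvec_subspace_corner])
  fix u assume "u \<in> antidiag n"
  then obtain a where a: "\<forall>k\<le>n. a k \<in> corner k (n - k)" "u = (\<lambda>y. \<Sum>k\<le>n. a k y)"
    unfolding antidiag_def by blast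
  show "(\<lambda>y. c * u y) \<in> antidiag n" for c
    unfolding antidiag_def using a
    by (auto intro!: exI[of _ "\<lambda>k y. c * a k y"] cvec_subspace_scale[OF cvec_subspace_corner]
        simp: sum_distrib_left)
  fix v assume "v \<in> antidiag n"
  then obtain b where b: "\<forall>k\<le>n. b k \<in> corner k (n - k)" "v = (\<lambda>y. \<Sum>k\<le>n. b k y)"
    unfolding antidiag_def by blast
  show "(\<lambda>y. u y + v y) \<in> antidiag n"
    unfolding antidiag_def using a b
    by (auto intro!: exI[of _ "\<lambda>k y. a k y + b k y"] cvec_subspace_add[OF cvec_subspace_corner]
        simp: sum.distrib)
qed

lemma corner_subset_antidiag:
  assumes "i + j = n"
  shows "corner i j \<subseteq> antidiag n"
proof
  fix v assume v: "v \<in> corner i j"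
  show "v \<in> antidiag n"
    unfolding antidiag_def using assms v cvec_subspace_zero[OF cvec_subspace_corner]
    by (auto intro!: exI[of _ "\<lambda>k. if k = i then v else (\<lambda>_. 0)"]
        simp: if_distrib[of "\<lambda>f. f _"] cong: if_cong)
qed

text \<open>Each piece u lies in \<open>antidiag n\<close> itself, so a multiple of u can be added
  back; the scalar may therefore depend on the piece.\<close>

lemma antidiag_invariant:
  assumes v: "v \<in> antidiag n"
    and M: "\<And>k u. k \<le> n \<Longrightarrow> u \<in> corner k (n - k) \<Longrightarrow> \<exists>c. (\<lambda>y. mapp M u y + - c * u y) \<in> antidiag n"
  shows "mapp M v \<in> antidiag n"
proof -
  note S = cvec_subspace_antidiag
  obtain w where w: "\<forall>k\<le>n. w k \<in> corner k (n - k)" "v = (\<lambda>y. \<Sum>k\<le>n. w k y)"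
    using v unfolding antidiag_def by blast
  have "mapp M (w k) \<in> antidiag n" if k: "k \<le> n" for k
  proof -
    obtain c where c: "(\<lambda>y. mapp M (w k) y + - c * w k y) \<in> antidiag n" using M k w(1) by blast
    have "w k \<in> antidiag n" using corner_subset_antidiag[of k "n - k" n] k w(1) by auto
    from cvec_subspace_add[OF S c cvec_subspace_scale[OF S this, of c]] show ?thesis by simp
  qed
  then show ?thesis unfolding w(2) mapp_sum by (intro cvec_subspace_sum[OF S]) auto
qed

lemma antidiag_A_invariant: "v \<in> antidiag n \<Longrightarrow> mapp A v \<in> antidiag n"
proof (erule antidiag_invariant)
  fix k u assume k: "k \<le> n" and u: "u \<in> corner k (n - k)"
  show "\<exists>c. (\<lambda>y. mapp A u y + - c * u y) \<in> antidiag n"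
  proof (cases "n - k")
    case 0
    then have "u \<in> corner k 0" using u by simp
    then show ?thesis
      using A_corner_zero[of u k] cvec_subspace_zero[OF cvec_subspace_antidiag]
      by (intro exI[of _ "\<theta> 0"]) simp
  next
    case (Suc j)
    then have "(\<lambda>y. mapp A u y + - \<theta> (Suc j) * u y) \<in> corner (Suc k) j" using u A_corner by simp
    moreover have "Suc k + j = n" using Suc by simp
    ultimately show ?thesis using corner_subset_antidiag by blast
  qed
qed

lemma antidiag_Astar_invariant: "v \<in> antidiag n \<Longrightarrow> mapp Astar v \<in> antidiag n"
proof (erule antidiag_invariant)
  fix k u assume k: "k \<le> n" and u: "u \<in> corner k (n - k)"
  show "\<exists>c. (\<lambda>y. mapp Astar u y + - c * u y) \<in> antidiag n"
  proof (cases k)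
    case 0
    then have "u \<in> corner 0 n" using u by simp
    then show ?thesis
      using Astar_corner_zero[of u n] cvec_subspace_zero[OF cvec_subspace_antidiag]
      by (intro exI[of _ "\<theta>s 0"]) simp
  next
    case (Suc i)
    then have "(\<lambda>y. mapp Astar u y + - \<theta>s (Suc i) * u y) \<in> corner i (Suc (n - k))"
      using u Astar_corner by simp
    moreover have "i + Suc (n - k) = n" using Suc k by simp
    ultimately show ?thesis using corner_subset_antidiag by blast
  qed
qed

text \<open>Membership in \<open>corner i j\<close> says that certain Hermitian operators annihilate
  the vector, and each of these leaves \<open>antidiag n\<close> invariant.\<close>

lemma antidiag_projection_corner:
  assumes p: "p \<in> antidiag n" and r: "\<And>u. u \<in> antidiag n \<Longrightarrow> cinner r u = 0"
    and v: "(\<lambda>y. p y + r y) \<in> corner i j"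
  shows "p \<in> corner i j"
proof -
  note S = cvec_subspace_antidiag[of n]
  \<comment> \<open>\<open>M p\<close> lies in \<open>antidiag n\<close> and \<open>M r\<close> is
    orthogonal to it, so \<open>M p + M r = 0\<close> forces \<open>M p\<close> to have norm
    zero.\<close>
  have vanish: "mapp M p = (\<lambda>_. 0)"
    if inv: "\<And>u. u \<in> antidiag n \<Longrightarrow> mapp M u \<in> antidiag n"
      and herm: "\<And>y z. cnj (M y z) = M z y" and 0: "mapp M (\<lambda>y. p y + r y) = (\<lambda>_. 0)" for M
  proof (rule cinner_self_eq_0)
    have "cinner (mapp M r) (mapp M p) = 0"
      unfolding cinner_mapp_hermitian[OF herm] using r inv p by simp
    moreover have "cinner (mapp M p) (mapp M p) + cinner (mapp M r) (mapp M p) = 0"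
      unfolding cinner_add_left[symmetric] using 0 unfolding mapp_add by (simp add: cinner_def)
    ultimately show "cinner (mapp M p) (mapp M p) = 0" by simp
  qed
  show ?thesis unfolding corner_def
  proof safe
    fix y assume y: "i < d x y"
    have "mapp (dual_idem Adj x (d x y)) p = (\<lambda>_. 0)"
    proof (rule vanish)
      show "mapp (dual_idem Adj x (d x y)) (\<lambda>y. p y + r y) = (\<lambda>_. 0)"
        using v y unfolding mapp_dual_idem corner_def by auto
      show "cnj (dual_idem Adj x (d x y) y' z) = dual_idem Adj x (d x y) z y'" for y' z
        by (auto simp: dual_idem_def)
    qed (rule Astar_invariant_dual_idem[OF S antidiag_Astar_invariant])
    from fun_cong[OF this, of y] show "p y = 0" unfolding mapp_dual_idem by simp
  next
    fix k assume k: "j < k" "k \<le> D"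
    show "mapp (E k) p = (\<lambda>_. 0)"
    proof (rule vanish)
      show "mapp (E k) (\<lambda>y. p y + r y) = (\<lambda>_. 0)" using v k unfolding corner_def by auto
    qed (use k in \<open>auto simp: E_hermitian intro: A_invariant_E[OF S antidiag_A_invariant]\<close>)
  qed
qed

text \<open>Split a sum of elements of the V_kl with k + l = i + j - 1 at k = i: the part with k < i
  lies in the first i - 1 dual eigenspaces, the other part in the first j - 1 eigenspaces, and as
  their sum lies in V_ij, each part satisfies the other condition as well.\<close>

lemma corner_inter_antidiag:
  assumes v: "v \<in> corner i j" "v \<in> antidiag n" and n: "Suc n = i + j" and j: "j \<le> D"
  shows "v \<in> set_plus_v (Vsp Adj E x (int i) (int j - 1)) (Vsp Adj E x (int i - 1) (int j))"
proof -
  obtain w where w: "\<And>k. k \<le> n \<Longrightarrow> w k \<in> corner k (n - k)" "v = (\<lambda>y. \<Sum>k\<le>n. w k y)"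
    using v(2) unfolding antidiag_def by blast
  define a where "a = (\<lambda>y. \<Sum>k<i. if k \<le> n then w k y else 0)"
  define b where "b = (\<lambda>y. \<Sum>k\<in>{i..n}. w k y)"
  have ba: "v = (\<lambda>y. b y + a y)"
  proof
    fix y
    have "a y = (\<Sum>k\<in>{..n} \<inter> {..<i}. w k y)"
      unfolding a_def by (subst sum.inter_filter[symmetric]) (auto intro: sum.cong)
    moreover have "{..n} = {i..n} \<union> ({..n} \<inter> {..<i})" by auto
    then have "(\<Sum>k\<le>n. w k y) = (\<Sum>k\<in>{i..n}. w k y) + (\<Sum>k\<in>{..n} \<inter> {..<i}. w k y)"
      by (subst (1) \<open>{..n} = _\<close>, intro sum.union_disjoint) auto
    ultimately show "v y = b y + a y" unfolding w(2) b_def by simp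
  qed
  have a1: "a y = 0" if "i \<le> d x y" for y
    unfolding a_def using that w(1) by (intro sum.neutral) (auto simp: corner_def)
  have b2: "mapp (E k) b = (\<lambda>_. 0)" if k: "j \<le> k" "k \<le> D" for k
  proof -
    have "mapp (E k) (w l) = (\<lambda>_. 0)" if "l \<in> {i..n}" for l
    proof -
      have "n - l < k" using that k n by auto
      then show ?thesis using w(1)[of l] that k by (auto simp: corner_def)
    qed
    then show ?thesis unfolding b_def mapp_sum by simp
  qed
  have b1: "b y = 0" if "i < d x y" for y
  proof -
    have "v y = 0" using v(1) that by (simp add: corner_def)
    then show ?thesis using a1[of y] that ba by simp
  qed
  have a2: "mapp (E k) a = (\<lambda>_. 0)" if k: "j < k" "k \<le> D" for k
  proof -
    have "mapp (E k) v = (\<lambda>_. 0)" using v(1) k by (simp add: corner_def)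
    then show ?thesis using b2[of k] k unfolding ba mapp_add by simp
  qed
  have "b \<in> Vsp Adj E x (int i) (int j - 1)"
  proof (cases j)
    case 0
    \<comment> \<open>Here n = i - 1, so the range from i to n is empty, in keeping with
      \<open>Vsp\<close> being zero at index -1.\<close>
    then have "b = (\<lambda>_. 0)" unfolding b_def using n by simp
    then show ?thesis using 0 by (simp add: Vsp_def)
  next
    case (Suc l)
    then have "b \<in> corner i l" using b1 b2 by (auto simp: corner_def)
    then show ?thesis using Vsp_corner[of l i] Suc j by simp
  qed
  moreover have "a \<in> Vsp Adj E x (int i - 1) (int j)"
  proof (cases i)
    case 0
    then have "a = (\<lambda>_. 0)" unfolding a_def by simp
    then show ?thesis using 0 by (simp add: Vsp_def)
  next
    case (Suc l)
    then have "a \<in> corner l j" using a1 a2 by (auto simp: corner_def)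
    then show ?thesis using Vsp_corner[of j l] Suc j by simp
  qed
  ultimately show ?thesis unfolding set_plus_v_def using ba by blast
qed

section \<open>Orthogonality to the antidiagonal sums, and the two inclusions\<close>

lemma Vtil_corner:
  assumes "i \<le> D" "j \<le> D" "v \<in> Vtil Adj E x (int i) (int j)"
  shows "v \<in> corner i j"
  using assms Vsp_corner[of j i] unfolding Vtil_def by simp

text \<open>The projection \<open>p\<close> of \<open>v\<close> lies in both V_ij and S_n, hence in
  the space to which \<open>v\<close> is orthogonal by definition. So
  \<open>cinner p p = cinner v p = 0\<close>, and \<open>v\<close> is its own orthogonal
  part.\<close>

lemma Vtil_orthogonal_antidiag:
  assumes i: "i \<le> D" and j: "j \<le> D" and v: "v \<in> Vtil Adj E x (int i) (int j)"
    and n: "Suc n = i + j" and u: "u \<in> antidiag n"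
  shows "cinner v u = 0"
proof -
  obtain p r where p: "p \<in> antidiag n" and r: "\<And>u. u \<in> antidiag n \<Longrightarrow> cinner r u = 0"
    and vpr: "v = (\<lambda>y. p y + r y)"
    using cvec_orthogonal_decomposition[OF cvec_subspace_antidiag] by metis
  have "p \<in> corner i j"
    using antidiag_projection_corner[OF p r] Vtil_corner[OF i j v] vpr by simp
  then have "p \<in> set_plus_v (Vsp Adj E x (int i) (int j - 1)) (Vsp Adj E x (int i - 1) (int j))"
    using corner_inter_antidiag p n j by blast
  then have "cinner v p = 0" using v i j unfolding Vtil_def by auto
  then have "cinner p p = 0" using r[OF p] unfolding vpr cinner_add_left by simp
  then have "p = (\<lambda>_. 0)" by (rule cinner_self_eq_0)
  then show ?thesis using r[OF u] vpr by simp
qed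

lemma Vsp_subset_antidiag:
  assumes "r + s = int n" "s \<le> int D"
  shows "Vsp Adj E x r s \<subseteq> antidiag n"
proof (cases "r < 0 \<or> s < 0")
  case True
  then show ?thesis
    using cvec_subspace_zero[OF cvec_subspace_antidiag] by (auto simp: Vsp_def)
next
  case False
  then have "Vsp Adj E x r s = corner (nat r) (nat s)"
    using Vsp_corner[of "nat s" "nat r"] assms by simp
  moreover have "nat r + nat s = n" using False assms by linarith
  ultimately show ?thesis using corner_subset_antidiag by blast
qed

lemma VtilI:
  assumes u: "u \<in> corner i j" and n: "Suc n = i + j"
    and orth: "\<And>t. t \<in> antidiag n \<Longrightarrow> cinner u t = 0"
    and bound: "i \<le> Suc D" "j \<le> Suc D"
  shows "u \<in> Vtil Adj E x (int i) (int j)"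
proof (cases "i \<le> D \<and> j \<le> D")
  case True
  have "cinner u t = 0"
    if t: "t \<in> set_plus_v (Vsp Adj E x (int i) (int j - 1)) (Vsp Adj E x (int i - 1) (int j))" for t
  proof -
    obtain a b where "t = (\<lambda>y. a y + b y)"
      "a \<in> Vsp Adj E x (int i) (int j - 1)" "b \<in> Vsp Adj E x (int i - 1) (int j)"
      using t unfolding set_plus_v_def by blast
    moreover have "Vsp Adj E x (int i) (int j - 1) \<subseteq> antidiag n" "Vsp Adj E x (int i - 1) (int j) \<subseteq> antidiag n"
      using n True by (simp_all add: Vsp_subset_antidiag)
    ultimately show ?thesis
      using orth[OF subsetD, of _ a] orth[OF subsetD, of _ b] by (simp add: cinner_add_right)
  qed
  then show ?thesis using True u Vsp_corner[of j i] unfolding Vtil_def by simp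
next
  case False
  \<comment> \<open>The index D + 1 can be lowered to \<open>D\<close>, which puts \<open>u\<close>
    into the very antidiagonal sum that it is orthogonal to.\<close>
  have "u \<in> antidiag n"
  proof (cases "i = Suc D")
    case True
    then have "u \<in> corner D j" using u corner_diameter(1)[of i j] by simp
    then show ?thesis using corner_subset_antidiag[of D j n] n True by auto
  next
    case i: False
    then have "j = Suc D" using False bound by auto
    then have "u \<in> corner i D" using u corner_diameter(2)[of j i] by simp
    then show ?thesis using corner_subset_antidiag[of i D n] n \<open>j = Suc D\<close> by auto
  qed
  then have "u = (\<lambda>_. 0)" using orth by (intro cinner_self_eq_0) simp
  then show ?thesis using False unfolding Vtil_def by auto
qed

lemma cinner_shift_eq_0:
  assumes herm: "\<And>y z. cnj (M y z) = M z y"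
    and inv: "\<And>u. u \<in> S \<Longrightarrow> mapp M u \<in> S"
    and v: "\<And>u. u \<in> S \<Longrightarrow> cinner v u = 0" and t: "t \<in> S"
  shows "cinner (\<lambda>y. mapp M v y + - c * v y) t = 0"
  unfolding cinner_add_left cinner_scale_left cinner_mapp_hermitian[OF herm] using v inv t by simp

lemma zero_in_Vtil: "(\<lambda>_. 0) \<in> Vtil Adj E x r s"
proof -
  have "(\<lambda>_. 0) \<in> Vsp Adj E x r s" if "0 \<le> r" "0 \<le> s" "s \<le> int D"
    using that Vsp_corner[of "nat s" "nat r"] cvec_subspace_zero[OF cvec_subspace_corner] by simp
  then show ?thesis unfolding Vtil_def by (simp add: cinner_def)
qed

lemma A_Vtil:
  assumes i: "i \<le> D" and j: "j \<le> D" and v: "v \<in> Vtil Adj E x (int i) (int j)"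
  shows "(\<lambda>y. mapp A v y + - \<theta> j * v y) \<in> Vtil Adj E x (int i + 1) (int j - 1)"
proof (cases j)
  case 0
  \<comment> \<open>The target has second index -1, so its \<open>Vtil\<close> is zero; the image is
    zero too, since \<open>E 0\<close> is the only component of \<open>v\<close>.\<close>
  then show ?thesis using A_corner_zero[of v i] Vtil_corner[OF i j v] zero_in_Vtil by simp
next
  case (Suc l)
  have "(\<lambda>y. mapp A v y + - \<theta> j * v y) \<in> Vtil Adj E x (int (Suc i)) (int l)"
  proof (rule VtilI[where n = "i + l"])
    show "(\<lambda>y. mapp A v y + - \<theta> j * v y) \<in> corner (Suc i) l"
      using A_corner Vtil_corner[OF i j v] Suc by simp
    show "cinner (\<lambda>y. mapp A v y + - \<theta> j * v y) t = 0" if "t \<in> antidiag (i + l)" for t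
      by (rule cinner_shift_eq_0[where S = "antidiag (i + l)"])
        (auto simp: Suc A_hermitian that
          intro: antidiag_A_invariant Vtil_orthogonal_antidiag[OF i j v])
  qed (use i j Suc in auto)
  then show ?thesis using Suc by (simp add: add.commute)
qed

lemma Astar_Vtil:
  assumes i: "i \<le> D" and j: "j \<le> D" and v: "v \<in> Vtil Adj E x (int i) (int j)"
  shows "(\<lambda>y. mapp Astar v y + - \<theta>s i * v y) \<in> Vtil Adj E x (int i - 1) (int j + 1)"
proof (cases i)
  case 0
  then show ?thesis using Astar_corner_zero[of v j] Vtil_corner[OF i j v] zero_in_Vtil by simp
next
  case (Suc l)
  have "(\<lambda>y. mapp Astar v y + - \<theta>s i * v y) \<in> Vtil Adj E x (int l) (int (Suc j))"
  proof (rule VtilI[where n = "l + j"])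
    show "(\<lambda>y. mapp Astar v y + - \<theta>s i * v y) \<in> corner l (Suc j)"
      using Astar_corner Vtil_corner[OF i j v] Suc by simp
    show "cinner (\<lambda>y. mapp Astar v y + - \<theta>s i * v y) t = 0" if "t \<in> antidiag (l + j)" for t
      by (rule cinner_shift_eq_0[where S = "antidiag (l + j)"])
        (auto simp: Suc Astar_hermitian that
          intro: antidiag_Astar_invariant Vtil_orthogonal_antidiag[OF i j v])
  qed (use i j Suc in auto)
  then show ?thesis using Suc by (simp add: add.commute)
qed

end

theorem mainTheorem10:
  fixes Adj :: "'a::finite \<Rightarrow> 'a \<Rightarrow> bool"
    and E :: "nat \<Rightarrow> 'a cmat"
    and \<theta> \<theta>s :: "nat \<Rightarrow> complex"
    and x :: 'a
    and i j :: nat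
  assumes drg: "distance_regular Adj"
    and diam: "diameter Adj \<ge> 3"
    and prim: "bij_betw E {..diameter Adj} {F. primitive_idempotent Adj F}"
    and qpoly: "Q_polynomial Adj E"
    and eig: "adjmat Adj = (\<lambda>y z. \<Sum>k\<le>diameter Adj. \<theta> k * E k y z)"
    and dualeig: "dual_adj E x = (\<lambda>y z. \<Sum>k\<le>diameter Adj. \<theta>s k * dual_idem Adj x k y z)"
    and i: "i \<le> diameter Adj" and j: "j \<le> diameter Adj"
  shows "(\<forall>v \<in> Vtil Adj E x (int i) (int j).
            mapp (\<lambda>y z. adjmat Adj y z - \<theta> j * idm y z) v
              \<in> Vtil Adj E x (int i + 1) (int j - 1))
       \<and> (\<forall>v \<in> Vtil Adj E x (int i) (int j).
            mapp (\<lambda>y z. dual_adj E x y z - \<theta>s i * idm y z) v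
              \<in> Vtil Adj E x (int i - 1) (int j + 1))"
proof -
  interpret q_polynomial_drg Adj E \<theta> \<theta>s x
    by unfold_locales (use drg diam prim qpoly eig dualeig in auto)
  show ?thesis unfolding mapp_shift using A_Vtil[OF i j] Astar_Vtil[OF i j] by blast
qed

end
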